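(* Let $q\in(0,1)$ and let $X\ge0$ almost surely be a finite-valued random variable with CDF $F_X$. Let $W^R$ have the stationary distribution of the GI/GI/1 waiting-time chain with resetting (see context), with CDF $F_{W^R}$, and let $P_{\mathrm{delay}}=1-F_{W^R}(0)$. Then, for $t\ge0$, $$\mathbb{E}\left[e^{-tW^R}\right]=\frac{q}{1-(1-q)\,\mathbb{E}[e^{-tX}]},$$ $$F_{W^R}(0)=\frac{q}{1-(1-q)F_X(0)},\qquad P_{\mathrm{delay}}=\frac{(1-q)(1-F_X(0))}{1-(1-q)F_X(0)}.$$ If $\mathbb{E}[X]<\infty$, then $\mathbb{E}[W^R]=\frac{1-q}{q}\mathbb{E}[X]$; if $\mathbb{E}[X^2]<\infty$, then $$\mathrm{Var}[W^R]=\frac{1-q}{q}\mathbb{E}[X^2]+\frac{(1-q)^2}{q^2}(\mathbb{E}[X])^2.$$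
   Context: $Y^+=\max(0,Y)$. The GI/GI/1 waiting-time chain with resetting is the discrete-time Markov chain $\{W^R_n\}_{n\ge0}$ on $[0,\infty)$ given by $W^R_{n+1}=Z_{n+1}(W^R_n+X_n)^+$, where $\{X_n\}_{n\ge0}$ are i.i.d. copies of $X$, $\{Z_n\}_{n\ge1}$ are i.i.d. Bernoulli with $\mathbb{P}(Z_n=0)=q=1-\mathbb{P}(Z_n=1)$, and $W^R_0\ge0$, $\{X_n\}$, $\{Z_n\}$ are independent. This chain has a unique stationary distribution. *)

theory Defs
  imports "HOL-Probability.Probability"
begin

(* The random inputs W_0, X_0, X_1, ... and Z_1, Z_2, ... of the chain.
   The variables X_n and Z_n are indexed separately, so that one step of the recursion
   uses X_n together with Z_(n+1); Reset 0 is never used. *)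
datatype input = Initial | Increment nat | Reset nat

definition inputs :: "input set" where
  "inputs = insert Initial (range Increment \<union> Reset ` {1..})"

primrec waiting_time :: "(input \<Rightarrow> 'a \<Rightarrow> real) \<Rightarrow> nat \<Rightarrow> 'a \<Rightarrow> real" where
  "waiting_time Y 0 \<omega> = Y Initial \<omega>"
| "waiting_time Y (Suc n) \<omega> =
     Y (Reset (Suc n)) \<omega> * max 0 (waiting_time Y n \<omega> + Y (Increment n) \<omega>)"

(* The law of the {0,1}-valued Bernoulli variables, with mass q at 0. *)
definition reset_law :: "real \<Rightarrow> real measure" where
  "reset_law q = distr (measure_pmf (bernoulli_pmf (1 - q))) borel of_bool"

locale resetting_chain = prob_space M
  for M :: "'a measure" and q :: real and \<mu> :: "real measure"
    and Y :: "input \<Rightarrow> 'a \<Rightarrow> real" +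
  assumes independent: "indep_vars (\<lambda>_. borel) Y inputs"
    and initial_nonneg: "AE \<omega> in M. 0 \<le> Y Initial \<omega>"
    and increment_law: "\<And>n. distr M borel (Y (Increment n)) = \<mu>"
    and reset_law: "\<And>n. n \<ge> 1 \<Longrightarrow> distr M borel (Y (Reset n)) = reset_law q"

(* The transition kernel: from state w the chain moves to Z (w + X)^+ with X ~ mu and
   Z Bernoulli, independent. *)
definition transition_kernel :: "real \<Rightarrow> real measure \<Rightarrow> real \<Rightarrow> real measure" where
  "transition_kernel q \<mu> w =
     distr (\<mu> \<Otimes>\<^sub>M reset_law q) borel (\<lambda>(x, z). z * max 0 (w + x))"

definition stationary_distribution :: "real \<Rightarrow> real measure \<Rightarrow> real measure \<Rightarrow> bool" where
  "stationary_distribution q \<mu> \<pi> \<longleftrightarrow>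
     prob_space \<pi> \<and> sets \<pi> = sets borel \<and> (AE w in \<pi>. 0 \<le> w) \<and>
     \<pi> \<bind> transition_kernel q \<mu> = \<pi>"

lemma prob_space_reset_law: "prob_space (reset_law q)"
  unfolding reset_law_def by (rule measure_pmf.prob_space_distr) simp

lemma sets_reset_law [measurable_cong, simp]: "sets (reset_law q) = sets borel"
  by (simp add: reset_law_def)

lemma measurable_transition_kernel:
  assumes "prob_space \<mu>" and sets_eq: "sets \<mu> = sets borel"
  shows "transition_kernel q \<mu> \<in> borel \<rightarrow>\<^sub>M subprob_algebra borel"
proof -
  note [measurable_cong] = sets_eq
  interpret mu: prob_space \<mu> by fact
  interpret reset: prob_space "reset_law q" by (rule prob_space_reset_law)
  interpret pair: pair_prob_space \<mu> "reset_law q" ..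
  have "(\<lambda>w. distr (\<mu> \<Otimes>\<^sub>M reset_law q) borel ((\<lambda>w (x, z). z * max 0 (w + x)) w))
      \<in> borel \<rightarrow>\<^sub>M subprob_algebra borel"
  proof (rule measurable_distr2)
    show "case_prod (\<lambda>w (x, z). z * max 0 (w + x))
        \<in> borel \<Otimes>\<^sub>M (\<mu> \<Otimes>\<^sub>M reset_law q) \<rightarrow>\<^sub>M (borel :: real measure)"
      by (simp add: split_beta') measurable
    show "(\<lambda>w. \<mu> \<Otimes>\<^sub>M reset_law q)
        \<in> borel \<rightarrow>\<^sub>M subprob_algebra (\<mu> \<Otimes>\<^sub>M reset_law q)"
      by (rule measurable_const)
        (simp add: space_subprob_algebra pair.prob_space_axioms prob_space_imp_subprob_space)
  qed
  then show ?thesis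
    by (simp add: transition_kernel_def[abs_def])
qed

lemma distr_pair_eq_bind_kernel:
  assumes "prob_space \<pi>" and "sets \<pi> = sets borel"
    and "prob_space \<mu>" and "sets \<mu> = sets borel"
  shows "distr (\<pi> \<Otimes>\<^sub>M (\<mu> \<Otimes>\<^sub>M reset_law q)) borel (\<lambda>(w, x, z). z * max 0 (w + x)) =
    \<pi> \<bind> transition_kernel q \<mu>"
proof -
  note [measurable_cong] = assms(2,4)
  interpret pi: prob_space \<pi> by fact
  interpret mu: prob_space \<mu> by fact
  interpret reset: prob_space "reset_law q" by (rule prob_space_reset_law)
  interpret step: pair_prob_space \<mu> "reset_law q" ..
  have sigma_finite: "sigma_finite_measure (\<mu> \<Otimes>\<^sub>M reset_law q)"
    by (rule prob_space_imp_sigma_finite[OF step.prob_space_axioms])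
  have kernel: "transition_kernel q \<mu> \<in> \<pi> \<rightarrow>\<^sub>M subprob_algebra borel"
    using measurable_transition_kernel[OF assms(3,4)] assms(2) by (simp cong: measurable_cong_sets)
  show ?thesis
  proof (rule measure_eqI)
    show "sets (distr (\<pi> \<Otimes>\<^sub>M (\<mu> \<Otimes>\<^sub>M reset_law q)) borel (\<lambda>(w, x, z). z * max 0 (w + x))) =
        sets (\<pi> \<bind> transition_kernel q \<mu>)"
      using kernel by (simp add: sets_bind[OF sets_kernel[OF kernel]] pi.not_empty)
  next
    fix A assume "A \<in> sets (distr (\<pi> \<Otimes>\<^sub>M (\<mu> \<Otimes>\<^sub>M reset_law q)) borel
      (\<lambda>(w, x, z). z * max 0 (w + x)) :: real measure)"
    then have A [measurable]: "A \<in> sets borel" by simp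
    have [measurable]: "(\<lambda>(w, x, z). z * max 0 (w + x))
        \<in> \<pi> \<Otimes>\<^sub>M (\<mu> \<Otimes>\<^sub>M reset_law q) \<rightarrow>\<^sub>M (borel :: real measure)"
      by (simp add: split_beta') measurable
    have [measurable]: "(\<lambda>(x, z). z * max 0 (w + x))
        \<in> \<mu> \<Otimes>\<^sub>M reset_law q \<rightarrow>\<^sub>M (borel :: real measure)" for w
      by (simp add: split_beta') measurable
    have "emeasure (distr (\<pi> \<Otimes>\<^sub>M (\<mu> \<Otimes>\<^sub>M reset_law q)) borel
          (\<lambda>(w, x, z). z * max 0 (w + x))) A =
        (\<integral>\<^sup>+ w. emeasure (\<mu> \<Otimes>\<^sub>M reset_law q) (Pair w -` ((\<lambda>(w, x, z). z * max 0 (w + x)) -` A \<inter>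
          space (\<pi> \<Otimes>\<^sub>M (\<mu> \<Otimes>\<^sub>M reset_law q)))) \<partial>\<pi>)"
      by (subst emeasure_distr) (measurable, rule sigma_finite_measure.emeasure_pair_measure_alt[OF sigma_finite], measurable)
    also have "\<dots> = (\<integral>\<^sup>+ w. emeasure (transition_kernel q \<mu> w) A \<partial>\<pi>)"
      unfolding transition_kernel_def
      by (intro nn_integral_cong, subst emeasure_distr)
        (auto intro!: arg_cong2[where f = emeasure] simp: space_pair_measure)
    also have "\<dots> = emeasure (\<pi> \<bind> transition_kernel q \<mu>) A"
      by (rule emeasure_bind[OF pi.not_empty kernel A, symmetric])
    finally show "emeasure (distr (\<pi> \<Otimes>\<^sub>M (\<mu> \<Otimes>\<^sub>M reset_law q)) borel
        (\<lambda>(w, x, z). z * max 0 (w + x))) A = emeasure (\<pi> \<bind> transition_kernel q \<mu>) A" .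
  qed
qed

definition past :: "nat \<Rightarrow> input set" where
  "past n = insert Initial (Increment ` {..<n} \<union> Reset ` {1..n})"

lemma waiting_time_restrict:
  "past n \<subseteq> J \<Longrightarrow>
    waiting_time (\<lambda>i y. y i) n (restrict (\<lambda>i. Y i \<omega>) J) = waiting_time Y n \<omega>"
proof (induction n)
  case (Suc n)
  have "past n \<subseteq> past (Suc n)" by (auto simp: past_def)
  then have "past n \<subseteq> J" using Suc.prems by blast
  note IH = Suc.IH[OF this]
  have "Reset (Suc n) \<in> J" "Increment n \<in> J"
    using Suc.prems by (auto simp: past_def)
  then show ?case by (simp only: waiting_time.simps IH restrict_apply')
qed (auto simp: past_def)

lemma measurable_waiting_time:
  "past n \<subseteq> J \<Longrightarrow> waiting_time (\<lambda>i y. y i) n \<in> PiM J (\<lambda>_. borel) \<rightarrow>\<^sub>M borel"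
proof (induction n)
  case (Suc n)
  have "past n \<subseteq> past (Suc n)" by (auto simp: past_def)
  with Suc have [measurable]: "waiting_time (\<lambda>i y. y i) n \<in> PiM J (\<lambda>_. borel) \<rightarrow>\<^sub>M borel"
    by auto
  have mem: "Reset (Suc n) \<in> J" "Increment n \<in> J"
    using Suc.prems by (auto simp: past_def)
  have [measurable]: "(\<lambda>y. y (Reset (Suc n))) \<in> PiM J (\<lambda>_. borel) \<rightarrow>\<^sub>M (borel :: real measure)"
    "(\<lambda>y. y (Increment n)) \<in> PiM J (\<lambda>_. borel) \<rightarrow>\<^sub>M (borel :: real measure)"
    using mem by (auto intro!: measurable_component_singleton)
  have "waiting_time (\<lambda>i y. y i) (Suc n) = (\<lambda>y. y (Reset (Suc n)) *
      max 0 (waiting_time (\<lambda>i y. y i) n y + y (Increment n)))"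
    by (rule ext) simp
  then show ?case by (simp only:) measurable
next
  case 0
  have "waiting_time (\<lambda>i y. y i) 0 = (\<lambda>y :: input \<Rightarrow> real. y Initial)"
    by (rule ext) simp
  with 0 show ?case
    by (simp only:) (auto intro!: measurable_component_singleton simp: past_def)
qed

context resetting_chain
begin

lemma random_variable_input: "i \<in> inputs \<Longrightarrow> random_variable borel (Y i)"
  using independent by (simp add: indep_vars_def)

(* The law of the chain evolves by the kernel, whatever the initial law, so its
   stationary laws are those of the kernel. *)
lemma distr_waiting_time_Suc:
  "distr M borel (waiting_time Y (Suc n)) =
    distr M borel (waiting_time Y n) \<bind> transition_kernel q \<mu>"
proof -
  let ?X = "Y (Increment n)" and ?Z = "Y (Reset (Suc n))"
  let ?W = "waiting_time Y n"
  let ?B = "{Increment n, Reset (Suc n)}"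
  have mem: "Increment n \<in> inputs" "Reset (Suc n) \<in> inputs"
    by (auto simp: inputs_def)
  have rv [measurable]: "?X \<in> borel_measurable M" "?Z \<in> borel_measurable M"
    using mem by (auto intro!: random_variable_input)
  have "indep_var (PiM (past n) (\<lambda>_. borel)) (\<lambda>\<omega>. restrict (\<lambda>i. Y i \<omega>) (past n))
      (PiM ?B (\<lambda>_. borel)) (\<lambda>\<omega>. restrict (\<lambda>i. Y i \<omega>) ?B)"
    by (rule indep_var_restrict[OF independent]) (auto simp: past_def inputs_def)
  then have split: "distr M (PiM (past n) (\<lambda>_. borel)) (\<lambda>\<omega>. restrict (\<lambda>i. Y i \<omega>) (past n)) \<Otimes>\<^sub>M
        distr M (PiM ?B (\<lambda>_. borel)) (\<lambda>\<omega>. restrict (\<lambda>i. Y i \<omega>) ?B) =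
      distr M (PiM (past n) (\<lambda>_. borel) \<Otimes>\<^sub>M PiM ?B (\<lambda>_. borel))
        (\<lambda>\<omega>. (restrict (\<lambda>i. Y i \<omega>) (past n), restrict (\<lambda>i. Y i \<omega>) ?B))"
    and past [measurable]:
      "(\<lambda>\<omega>. restrict (\<lambda>i. Y i \<omega>) (past n)) \<in> M \<rightarrow>\<^sub>M PiM (past n) (\<lambda>_. borel)"
    and now [measurable]:
      "(\<lambda>\<omega>. restrict (\<lambda>i. Y i \<omega>) ?B) \<in> M \<rightarrow>\<^sub>M PiM ?B (\<lambda>_. borel)"
    by (simp_all add: indep_var_distribution_eq)
  let ?f = "waiting_time (\<lambda>i y. y i) n"
  let ?g = "\<lambda>y :: input \<Rightarrow> real. (y (Increment n), y (Reset (Suc n)))"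
  have f [measurable]: "?f \<in> PiM (past n) (\<lambda>_. borel) \<rightarrow>\<^sub>M borel"
    by (rule measurable_waiting_time) simp
  have g [measurable]: "?g \<in> PiM ?B (\<lambda>_. borel) \<rightarrow>\<^sub>M borel \<Otimes>\<^sub>M borel"
    by (intro measurable_Pair measurable_component_singleton) auto
  have Wf: "?W = ?f \<circ> (\<lambda>\<omega>. restrict (\<lambda>i. Y i \<omega>) (past n))"
    by (rule ext) (simp add: waiting_time_restrict[OF order.refl] del: restrict_apply)
  have XZg: "(\<lambda>\<omega>. (?X \<omega>, ?Z \<omega>)) = ?g \<circ> (\<lambda>\<omega>. restrict (\<lambda>i. Y i \<omega>) ?B)"
    by (rule ext) simp
  have W [measurable]: "?W \<in> borel_measurable M"
    unfolding Wf by measurable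
  have joint': "distr M borel ?W \<Otimes>\<^sub>M distr M (borel \<Otimes>\<^sub>M borel) (\<lambda>\<omega>. (?X \<omega>, ?Z \<omega>)) =
      distr M (borel \<Otimes>\<^sub>M (borel \<Otimes>\<^sub>M borel)) (\<lambda>\<omega>. (?W \<omega>, ?X \<omega>, ?Z \<omega>))"
  proof -
    have "distr M borel ?W = distr (distr M (PiM (past n) (\<lambda>_. borel))
        (\<lambda>\<omega>. restrict (\<lambda>i. Y i \<omega>) (past n))) borel ?f"
      unfolding Wf by (rule distr_distr[symmetric]) measurable
    moreover have XZd: "distr M (borel \<Otimes>\<^sub>M borel) (\<lambda>\<omega>. (?X \<omega>, ?Z \<omega>)) =
        distr (distr M (PiM ?B (\<lambda>_. borel)) (\<lambda>\<omega>. restrict (\<lambda>i. Y i \<omega>) ?B))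
          (borel \<Otimes>\<^sub>M borel) ?g"
      unfolding XZg by (rule distr_distr[OF g now, symmetric])
    ultimately have "distr M borel ?W \<Otimes>\<^sub>M distr M (borel \<Otimes>\<^sub>M borel) (\<lambda>\<omega>. (?X \<omega>, ?Z \<omega>)) =
        distr (distr M (PiM (past n) (\<lambda>_. borel)) (\<lambda>\<omega>. restrict (\<lambda>i. Y i \<omega>) (past n)) \<Otimes>\<^sub>M
          distr M (PiM ?B (\<lambda>_. borel)) (\<lambda>\<omega>. restrict (\<lambda>i. Y i \<omega>) ?B))
          (borel \<Otimes>\<^sub>M (borel \<Otimes>\<^sub>M borel)) (\<lambda>(x, y). (?f x, ?g y))"
      using f g
      by (simp only:) (rule pair_measure_distr, simp_all add: XZd[symmetric]
        prob_space_imp_sigma_finite prob_space_distr)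
    also have "\<dots> = distr M (borel \<Otimes>\<^sub>M (borel \<Otimes>\<^sub>M borel)) ((\<lambda>(x, y). (?f x, ?g y)) \<circ>
        (\<lambda>\<omega>. (restrict (\<lambda>i. Y i \<omega>) (past n), restrict (\<lambda>i. Y i \<omega>) ?B)))"
      unfolding split by (rule distr_distr) measurable
    also have "\<dots> = distr M (borel \<Otimes>\<^sub>M (borel \<Otimes>\<^sub>M borel)) (\<lambda>\<omega>. (?W \<omega>, ?X \<omega>, ?Z \<omega>))"
      using fun_cong[OF Wf] fun_cong[OF XZg]
      by (intro arg_cong[where f = "distr M (borel \<Otimes>\<^sub>M (borel \<Otimes>\<^sub>M borel))"] ext) simp
    finally show ?thesis .
  qed
  have "indep_var (PiM {Increment n} (\<lambda>_. borel)) (\<lambda>\<omega>. restrict (\<lambda>i. Y i \<omega>) {Increment n})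
      (PiM {Reset (Suc n)} (\<lambda>_. borel)) (\<lambda>\<omega>. restrict (\<lambda>i. Y i \<omega>) {Reset (Suc n)})"
    by (rule indep_var_restrict[OF independent]) (auto simp: inputs_def)
  from indep_var_compose[OF this, of "\<lambda>y. y (Increment n)" borel "\<lambda>y. y (Reset (Suc n))" borel]
  have X_Z: "indep_var borel ?X borel ?Z"
    by (auto simp: comp_def intro!: measurable_component_singleton)
  have XZ: "distr M (borel \<Otimes>\<^sub>M borel) (\<lambda>\<omega>. (?X \<omega>, ?Z \<omega>)) = \<mu> \<Otimes>\<^sub>M reset_law q"
    using X_Z[unfolded indep_var_distribution_eq] increment_law[of n] reset_law[of "Suc n"]
    by simp
  have joint: "distr M (borel \<Otimes>\<^sub>M (borel \<Otimes>\<^sub>M borel)) (\<lambda>\<omega>. (?W \<omega>, ?X \<omega>, ?Z \<omega>)) =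
      distr M borel ?W \<Otimes>\<^sub>M (\<mu> \<Otimes>\<^sub>M reset_law q)"
    using joint' XZ by simp
  have mu: "prob_space \<mu>" "sets \<mu> = sets borel"
    using prob_space_distr[OF rv(1)] by (auto simp flip: increment_law[of n])
  have [measurable]: "(\<lambda>(w, x, z). z * max 0 (w + x))
      \<in> borel \<Otimes>\<^sub>M (borel \<Otimes>\<^sub>M borel) \<rightarrow>\<^sub>M (borel :: real measure)"
    by (simp add: split_beta') measurable
  have "distr M borel (waiting_time Y (Suc n)) =
      distr M borel ((\<lambda>(w, x, z). z * max 0 (w + x)) \<circ> (\<lambda>\<omega>. (?W \<omega>, ?X \<omega>, ?Z \<omega>)))"
    by (rule arg_cong[where f = "distr M borel"]) (rule ext, simp)
  also have "\<dots> = distr (distr M (borel \<Otimes>\<^sub>M (borel \<Otimes>\<^sub>M borel)) (\<lambda>\<omega>. (?W \<omega>, ?X \<omega>, ?Z \<omega>)))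
      borel (\<lambda>(w, x, z). z * max 0 (w + x))"
    by (rule distr_distr[symmetric]) measurable
  also have "\<dots> = distr M borel ?W \<bind> transition_kernel q \<mu>"
    unfolding joint by (rule distr_pair_eq_bind_kernel) (auto intro!: prob_space_distr mu)
  finally show ?thesis .
qed

end

end

theory Submission
  imports Defs
begin

text \<open>
  Stationarity means $E f(W) = q f(0) + (1-q) E f(W + X)$ with $W$ and $X$ independent, for
  every $f \ge 0$: the increments being nonnegative, the positive part disappears. The choices
  $f(w) = e^{-tw}$, $f = 1_{\{w \le 0\}}$, $f(w) = w$ and $f(w) = w^2$ give linear equations
  for the four quantities. For the moments, the equations are first used with the bounded
  function $\min(w, K)^p$, as inequalities, to see that the moments of $W$ are finite.
\<close>

section \<open>Integrability from uniformly bounded truncated moments\<close>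

text \<open>Monotone convergence: as \<open>W\<close> is nonnegative almost surely, the truncated
  powers increase to \<open>W a ^ p\<close>, and the bound \<open>C\<close>, being the same for all
  \<open>K\<close>, makes their integrals converge.\<close>

lemma integrable_power_if_truncations_bounded:
  fixes W :: "'b \<Rightarrow> real" and p :: nat
  assumes [measurable]: "W \<in> borel_measurable N" and nonneg: "AE a in N. 0 \<le> W a"
    and int: "\<And>K :: nat. integrable N (\<lambda>a. min (W a) K ^ p)"
    and le: "\<And>K :: nat. (\<integral>a. min (W a) K ^ p \<partial>N) \<le> C"
  shows "integrable N (\<lambda>a. W a ^ p)"
proof -
  have mono: "AE a in N. incseq (\<lambda>K :: nat. min (W a) K ^ p)"
    using nonneg by eventually_elim (auto simp: incseq_def intro!: power_mono)
  have lim: "AE a in N. (\<lambda>K :: nat. min (W a) K ^ p) \<longlonglongrightarrow> W a ^ p"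
  proof (rule AE_I2)
    fix a
    \<comment> \<open>From \<open>K0\<close> on the truncation has no effect at \<open>a\<close>, so
      the sequence is eventually constant.\<close>
    obtain K0 :: nat where "W a \<le> K0" using real_arch_simple by blast
    then have "\<forall>\<^sub>F K in sequentially. min (W a) (real K) ^ p = W a ^ p"
      by (auto simp: eventually_sequentially min_def intro!: exI[of _ K0])
    then show "(\<lambda>K :: nat. min (W a) K ^ p) \<longlonglongrightarrow> W a ^ p"
      by (rule tendsto_eventually)
  qed
  have "incseq (\<lambda>K :: nat. \<integral>a. min (W a) K ^ p \<partial>N)"
  proof (rule incseq_SucI, rule integral_mono_AE[OF int int])
    show "AE a in N. min (W a) (real K) ^ p \<le> min (W a) (real (Suc K)) ^ p" for K
      using mono by eventually_elim (rule incseq_SucD)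
  qed
  then obtain L where "(\<lambda>K :: nat. \<integral>a. min (W a) K ^ p \<partial>N) \<longlonglongrightarrow> L"
    using incseq_convergent[of _ C] le by blast
  then show ?thesis
    using mono by (intro integrable_monotone_convergence[OF int _ lim]) simp_all
qed

section \<open>The stationarity equation in integral form\<close>

lemma nn_integral_reset_law:
  assumes "0 < q" "q < 1" and [measurable]: "f \<in> borel_measurable borel"
  shows "(\<integral>\<^sup>+ z. f z \<partial>reset_law q) = ennreal q * f 0 + ennreal (1 - q) * f 1"
proof -
  have "(\<integral>\<^sup>+ z. f z \<partial>reset_law q) = (\<integral>\<^sup>+ b. f (of_bool b) \<partial>measure_pmf (bernoulli_pmf (1 - q)))"
    unfolding reset_law_def by (subst nn_integral_distr) auto
  also have "\<dots> = ennreal q * f 0 + ennreal (1 - q) * f 1"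
    using assms by (subst nn_integral_bernoulli_pmf) (auto simp: mult.commute add.commute)
  finally show ?thesis .
qed

text \<open>Only the laws of \<open>X\<close> and \<open>W\<close> enter \<open>stationary\<close>,
  so the two variables may live on different spaces. Independence of \<open>W\<close> and
  \<open>X\<close> is expressed below by iterated integrals over \<open>M\<close> and
  \<open>N\<close>.\<close>

locale stationary_pair = M: prob_space M + N: prob_space N
  for M :: "'a measure" and N :: "'b measure" +
  fixes q :: real and X :: "'a \<Rightarrow> real" and W :: "'b \<Rightarrow> real"
  assumes q: "0 < q" "q < 1"
    and X [measurable]: "X \<in> borel_measurable M" and X_nonneg: "AE b in M. 0 \<le> X b"
    and W [measurable]: "W \<in> borel_measurable N"
    and stationary: "stationary_distribution q (distr M borel X) (distr N borel W)"
begin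

lemma W_nonneg: "AE a in N. 0 \<le> W a"
proof -
  have "AE w in distr N borel W. 0 \<le> w"
    using stationary unfolding stationary_distribution_def by blast
  then show ?thesis by (simp add: AE_distr_iff)
qed

text \<open>Integrate \<open>f\<close> against both sides of the fixed-point equation for the kernel
  and split according to the value of the reset variable. With \<open>f\<close> valued in the
  extended nonnegative reals, no integrability has to be known beforehand.\<close>

lemma nn_integral_stationary:
  assumes f [measurable]: "f \<in> borel_measurable borel"
  shows "(\<integral>\<^sup>+ a. f (W a) \<partial>N) =
    ennreal q * f 0 + ennreal (1 - q) * (\<integral>\<^sup>+ a. \<integral>\<^sup>+ b. f (W a + X b) \<partial>M \<partial>N)"
proof -
  interpret W: prob_space "distr N borel W" by (rule N.prob_space_distr) simp
  interpret X: prob_space "distr M borel X" by (rule M.prob_space_distr) simp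
  interpret Z: prob_space "reset_law q" by (rule prob_space_reset_law)
  interpret XZ: pair_prob_space "distr M borel X" "reset_law q" ..
  have kernel: "transition_kernel q (distr M borel X)
      \<in> distr N borel W \<rightarrow>\<^sub>M subprob_algebra borel"
    using measurable_transition_kernel[OF X.prob_space_axioms]
    by (simp cong: measurable_cong_sets)
  have inner: "(\<integral>\<^sup>+ y. f y \<partial>transition_kernel q (distr M borel X) w) =
      ennreal q * f 0 + ennreal (1 - q) * (\<integral>\<^sup>+ b. f (w + X b) \<partial>M)" if "0 \<le> w" for w
  proof -
    have [measurable]: "(\<lambda>(x, z). z * max 0 (w + x))
        \<in> distr M borel X \<Otimes>\<^sub>M reset_law q \<rightarrow>\<^sub>M (borel :: real measure)"
      by (simp add: split_beta') measurable
    have "(\<integral>\<^sup>+ y. f y \<partial>transition_kernel q (distr M borel X) w) =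
        (\<integral>\<^sup>+ p. f (snd p * max 0 (w + fst p)) \<partial>(distr M borel X \<Otimes>\<^sub>M reset_law q))"
      unfolding transition_kernel_def by (subst nn_integral_distr) (auto simp: split_beta')
    also have "\<dots> = (\<integral>\<^sup>+ x. \<integral>\<^sup>+ z. f (z * max 0 (w + x)) \<partial>reset_law q \<partial>distr M borel X)"
      by (subst Z.nn_integral_fst[symmetric]) auto
    also have "\<dots> = (\<integral>\<^sup>+ x. ennreal q * f 0 + ennreal (1 - q) * f (max 0 (w + x)) \<partial>distr M borel X)"
      by (subst nn_integral_reset_law[OF q]) auto
    also have "\<dots> = (\<integral>\<^sup>+ b. ennreal q * f 0 + ennreal (1 - q) * f (max 0 (w + X b)) \<partial>M)"
      by (subst nn_integral_distr) auto
    also have "\<dots> = (\<integral>\<^sup>+ b. ennreal q * f 0 + ennreal (1 - q) * f (w + X b) \<partial>M)"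
      \<comment> \<open>The positive part disappears: \<open>w\<close> is nonnegative and so is
        \<open>X b\<close> for almost every \<open>b\<close>.\<close>
      by (intro nn_integral_cong_AE eventually_mono[OF X_nonneg]) (use that in auto)
    also have "\<dots> = ennreal q * f 0 + ennreal (1 - q) * (\<integral>\<^sup>+ b. f (w + X b) \<partial>M)"
      by (simp add: nn_integral_add nn_integral_cmult M.emeasure_space_1)
    finally show ?thesis .
  qed
  have "(\<integral>\<^sup>+ a. f (W a) \<partial>N) = (\<integral>\<^sup>+ w. f w \<partial>distr N borel W)"
    by (subst nn_integral_distr) auto
  also have "\<dots> = (\<integral>\<^sup>+ w. f w \<partial>(distr N borel W \<bind> transition_kernel q (distr M borel X)))"
    using stationary by (simp add: stationary_distribution_def)
  also have "\<dots> = (\<integral>\<^sup>+ w. \<integral>\<^sup>+ y. f y \<partial>transition_kernel q (distr M borel X) w \<partial>distr N borel W)"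
    by (rule nn_integral_bind[OF f kernel])
  also have "\<dots> = (\<integral>\<^sup>+ a. \<integral>\<^sup>+ y. f y \<partial>transition_kernel q (distr M borel X) (W a) \<partial>N)"
    \<comment> \<open>The change of variables needs the integral of \<open>f\<close> under the
      kernel to be a measurable function of the state.\<close>
    using nn_integral_measurable_subprob_algebra2[of "\<lambda>_ y. f y" borel borel]
      measurable_transition_kernel[OF X.prob_space_axioms]
    by (subst nn_integral_distr)
      (auto intro!: nn_integral_measurable_subprob_algebra2[where N = borel])
  also have "\<dots> = (\<integral>\<^sup>+ a. ennreal q * f 0 + ennreal (1 - q) * (\<integral>\<^sup>+ b. f (W a + X b) \<partial>M) \<partial>N)"
    by (intro nn_integral_cong_AE eventually_mono[OF W_nonneg]) (rule inner)
  also have "\<dots> = ennreal q * f 0 + ennreal (1 - q) * (\<integral>\<^sup>+ a. \<integral>\<^sup>+ b. f (W a + X b) \<partial>M \<partial>N)"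
    by (simp add: nn_integral_add nn_integral_cmult N.emeasure_space_1)
  finally show ?thesis .
qed

text \<open>Finiteness of the right-hand side yields integrability on the left. For
  \<open>f x = x\<close> and integrable \<open>X\<close>, however, \<open>outer\<close> already
  amounts to integrability of \<open>W\<close>; this is why moments need truncation first.\<close>

lemma stationary_integral:
  fixes f :: "real \<Rightarrow> real"
  assumes f [measurable]: "f \<in> borel_measurable borel" and nonneg: "\<And>x. 0 \<le> x \<Longrightarrow> 0 \<le> f x"
    and inner: "AE a in N. integrable M (\<lambda>b. f (W a + X b))"
    and outer: "integrable N (\<lambda>a. \<integral>b. f (W a + X b) \<partial>M)"
  shows "integrable N (\<lambda>a. f (W a))" (is ?int)
    and "(\<integral>a. f (W a) \<partial>N) = q * f 0 + (1 - q) * (\<integral>a. \<integral>b. f (W a + X b) \<partial>M \<partial>N)" (is ?eq)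
proof -
  have f_nonneg: "AE a in N. AE b in M. 0 \<le> f (W a + X b)"
    using W_nonneg
  proof eventually_elim
    case (elim a)
    show ?case using X_nonneg by eventually_elim (use elim nonneg in auto)
  qed
  then have inner_nonneg: "AE a in N. 0 \<le> (\<integral>b. f (W a + X b) \<partial>M)"
    by eventually_elim (rule integral_nonneg_AE)
  have "(\<integral>\<^sup>+ a. ennreal (f (W a)) \<partial>N) = ennreal q * ennreal (f 0) +
      ennreal (1 - q) * (\<integral>\<^sup>+ a. \<integral>\<^sup>+ b. ennreal (f (W a + X b)) \<partial>M \<partial>N)"
    by (rule nn_integral_stationary) simp
  also have "(\<integral>\<^sup>+ a. \<integral>\<^sup>+ b. ennreal (f (W a + X b)) \<partial>M \<partial>N) =
      (\<integral>\<^sup>+ a. ennreal (\<integral>b. f (W a + X b) \<partial>M) \<partial>N)"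
  proof (rule nn_integral_cong_AE)
    show "AE a in N. (\<integral>\<^sup>+ b. ennreal (f (W a + X b)) \<partial>M) = ennreal (\<integral>b. f (W a + X b) \<partial>M)"
      using f_nonneg inner by eventually_elim (rule nn_integral_eq_integral)
  qed
  also have "\<dots> = ennreal (\<integral>a. \<integral>b. f (W a + X b) \<partial>M \<partial>N)"
    by (rule nn_integral_eq_integral[OF outer inner_nonneg])
  also have "ennreal q * ennreal (f 0) + ennreal (1 - q) * \<dots> =
      ennreal (q * f 0 + (1 - q) * (\<integral>a. \<integral>b. f (W a + X b) \<partial>M \<partial>N))"
    using q nonneg[of 0] integral_nonneg_AE[OF inner_nonneg]
    by (simp add: ennreal_mult)
  \<comment> \<open>A finite nonnegative integral gives integrability and the value at once.\<close>
  finally have "has_bochner_integral N (\<lambda>a. f (W a))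
      (q * f 0 + (1 - q) * (\<integral>a. \<integral>b. f (W a + X b) \<partial>M \<partial>N))"
    using W_nonneg q nonneg[of 0] integral_nonneg_AE[OF inner_nonneg] nonneg
    by (intro has_bochner_integral_nn_integral) auto
  then show ?int ?eq by (auto simp: has_bochner_integral_iff)
qed

text \<open>On a probability space boundedness settles all integrability conditions. Bounds on the
  nonnegative half-line suffice, because \<open>W\<close> and \<open>W + X\<close> lie there almost
  surely; \<open>exp (- t * x)\<close> and truncated powers can be unbounded on the negative
  side.\<close>

lemma stationary_integral_bounded:
  fixes f :: "real \<Rightarrow> real"
  assumes f [measurable]: "f \<in> borel_measurable borel"
    and bounds: "\<And>x. 0 \<le> x \<Longrightarrow> 0 \<le> f x \<and> f x \<le> C"
  shows "integrable N (\<lambda>a. f (W a))"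
    and "AE a in N. integrable M (\<lambda>b. f (W a + X b))"
    and "integrable N (\<lambda>a. \<integral>b. f (W a + X b) \<partial>M)"
    and "(\<integral>a. f (W a) \<partial>N) = q * f 0 + (1 - q) * (\<integral>a. \<integral>b. f (W a + X b) \<partial>M \<partial>N)"
proof -
  have f_bounds: "AE a in N. AE b in M. 0 \<le> f (W a + X b) \<and> f (W a + X b) \<le> C"
    using W_nonneg
  proof eventually_elim
    case (elim a)
    show ?case using X_nonneg by eventually_elim (use elim bounds in auto)
  qed
  show inner: "AE a in N. integrable M (\<lambda>b. f (W a + X b))"
    using f_bounds
  proof eventually_elim
    case (elim a)
    then show ?case by (intro M.integrable_const_bound[where B = C]) auto
  qed
  have "AE a in N. norm (\<integral>b. f (W a + X b) \<partial>M) \<le> C"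
    using f_bounds inner
  proof eventually_elim
    case (elim a)
    then have "0 \<le> (\<integral>b. f (W a + X b) \<partial>M)"
      by (intro integral_nonneg_AE) auto
    moreover have "(\<integral>b. f (W a + X b) \<partial>M) \<le> C"
      using elim by (intro M.integral_le_const) auto
    ultimately show ?case by simp
  qed
  then show outer: "integrable N (\<lambda>a. \<integral>b. f (W a + X b) \<partial>M)"
    by (intro N.integrable_const_bound[where B = C]) auto
  show "integrable N (\<lambda>a. f (W a))"
    and "(\<integral>a. f (W a) \<partial>N) = q * f 0 + (1 - q) * (\<integral>a. \<integral>b. f (W a + X b) \<partial>M \<partial>N)"
    using stationary_integral[OF f _ inner outer] bounds by auto
qed

section \<open>Laplace transform and mass at zero\<close>

text \<open>This is the form the equation takes when \<open>f\<close> turns sums into products: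
  \<open>u\<close> is the integral of \<open>f (W a)\<close> and \<open>v\<close> that of
  \<open>f (X b)\<close>. The denominator is at least \<open>q\<close>, since
  \<open>v \<le> 1\<close>.\<close>

lemma solve_stationary_equation:
  assumes "u = q + (1 - q) * (u * v)" and "v \<le> 1"
  shows "1 - (1 - q) * v > 0" and "u = q / (1 - (1 - q) * v)"
proof -
  have "(1 - q) * v \<le> 1 - q" using q assms mult_left_mono[of v 1 "1 - q"] by simp
  then show pos: "1 - (1 - q) * v > 0" using q by linarith
  have "u * (1 - (1 - q) * v) = q" using assms(1) by (simp add: algebra_simps)
  then show "u = q / (1 - (1 - q) * v)" using pos by (simp add: eq_divide_eq)
qed

text \<open>The exponential of a sum factors, so the double integral is the product of the two
  transforms.\<close>

lemma laplace_transform_stationary: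
  assumes "0 \<le> t"
  shows "(\<integral>a. exp (- t * W a) \<partial>N) = q / (1 - (1 - q) * (\<integral>b. exp (- t * X b) \<partial>M))"
proof (rule solve_stationary_equation)
  have "(\<integral>a. exp (- t * W a) \<partial>N) =
      q * exp (- t * 0) + (1 - q) * (\<integral>a. \<integral>b. exp (- t * (W a + X b)) \<partial>M \<partial>N)"
    by (rule stationary_integral_bounded[where C = 1]) (use assms in auto)
  also have "(\<integral>a. \<integral>b. exp (- t * (W a + X b)) \<partial>M \<partial>N) =
      (\<integral>a. exp (- t * W a) \<partial>N) * (\<integral>b. exp (- t * X b) \<partial>M)"
  proof -
    have "exp (- t * (w + x)) = exp (- t * w) * exp (- t * x)" for w x
      by (simp add: algebra_simps flip: exp_add)
    then show ?thesis by (simp only: integral_mult_right_zero integral_mult_left_zero)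
  qed
  finally show "(\<integral>a. exp (- t * W a) \<partial>N) =
      q + (1 - q) * ((\<integral>a. exp (- t * W a) \<partial>N) * (\<integral>b. exp (- t * X b) \<partial>M))"
    by simp
  have le: "AE b in M. exp (- t * X b) \<le> 1"
    using X_nonneg by eventually_elim (use assms in auto)
  then have "integrable M (\<lambda>b. exp (- t * X b))"
    by (intro M.integrable_const_bound[where B = 1]) auto
  with le show "(\<integral>b. exp (- t * X b) \<partial>M) \<le> 1"
    by (intro M.integral_le_const)
qed

text \<open>A sum of two nonnegative numbers is at most 0 exactly when both are, so the indicator of
  \<open>{..0}\<close> is multiplicative on the nonnegative reals. Positivity of the denominator is
  recorded for the delay probability.\<close>

lemma cdf_0_stationary:
  shows "1 - (1 - q) * cdf (distr M borel X) 0 > 0"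
    and "cdf (distr N borel W) 0 = q / (1 - (1 - q) * cdf (distr M borel X) 0)"
proof -
  define f :: "real \<Rightarrow> real" where "f = indicator {..0}"
  have [measurable]: "f \<in> borel_measurable borel" by (simp add: f_def)
  have cdf_eq: "cdf (distr L borel Y) 0 = (\<integral>c. f (Y c) \<partial>L)"
    if "Y \<in> borel_measurable L" for L :: "'c measure" and Y
  proof -
    note [measurable] = that
    have "cdf (distr L borel Y) 0 = (\<integral>y. f y \<partial>distr L borel Y)"
      by (simp add: cdf_def f_def)
    also have "\<dots> = (\<integral>c. f (Y c) \<partial>L)"
      by (rule integral_distr) auto
    finally show ?thesis .
  qed
  have prod: "AE a in N. (\<integral>b. f (W a + X b) \<partial>M) = f (W a) * (\<integral>b. f (X b) \<partial>M)"
    using W_nonneg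
  proof eventually_elim
    case (elim a)
    have "(\<integral>b. f (W a + X b) \<partial>M) = (\<integral>b. f (W a) * f (X b) \<partial>M)"
    proof (rule integral_cong_AE)
      show "AE b in M. f (W a + X b) = f (W a) * f (X b)"
        using X_nonneg by eventually_elim (use elim in \<open>auto simp: f_def indicator_def\<close>)
    qed auto
    then show ?case by simp
  qed
  have "(\<integral>a. f (W a) \<partial>N) = q * f 0 + (1 - q) * (\<integral>a. \<integral>b. f (W a + X b) \<partial>M \<partial>N)"
    by (rule stationary_integral_bounded[where C = 1]) (auto simp: f_def indicator_def)
  also have "(\<integral>a. \<integral>b. f (W a + X b) \<partial>M \<partial>N) = (\<integral>a. f (W a) * (\<integral>b. f (X b) \<partial>M) \<partial>N)"
    using prod by (intro integral_cong_AE) auto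
  finally have eq: "cdf (distr N borel W) 0 =
      q + (1 - q) * (cdf (distr N borel W) 0 * cdf (distr M borel X) 0)"
    by (simp add: cdf_eq) (simp add: f_def)
  interpret X: prob_space "distr M borel X" by (rule M.prob_space_distr) simp
  have le: "cdf (distr M borel X) 0 \<le> 1" by (simp add: cdf_def)
  show "1 - (1 - q) * cdf (distr M borel X) 0 > 0"
    and "cdf (distr N borel W) 0 = q / (1 - (1 - q) * cdf (distr M borel X) 0)"
    using solve_stationary_equation[OF eq le] by auto
qed

section \<open>Moments and variance\<close>

text \<open>Moving \<open>(1 - q) * u\<close> to the left leaves \<open>q * u\<close>. This is
  legitimate for truncated moments, which are finite real numbers.\<close>

lemma contraction_bound:
  assumes "u \<le> (1 - q) * (u + v)"
  shows "u \<le> (1 - q) / q * v"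
proof -
  have "u * q \<le> (1 - q) * v" using assms by (simp add: algebra_simps)
  then show ?thesis using q by (simp add: field_simps)
qed

lemma truncated_power:
  fixes K p :: nat
  assumes "0 < p"
  shows "integrable N (\<lambda>a. min (W a) K ^ p)"
    and "AE a in N. integrable M (\<lambda>b. min (W a + X b) K ^ p)"
    and "integrable N (\<lambda>a. \<integral>b. min (W a + X b) K ^ p \<partial>M)"
    and "(\<integral>a. min (W a) K ^ p \<partial>N) = (1 - q) * (\<integral>a. \<integral>b. min (W a + X b) K ^ p \<partial>M \<partial>N)"
proof -
  have bounds: "0 \<le> min x (real K) ^ p \<and> min x (real K) ^ p \<le> real K ^ p" if "0 \<le> x" for x
    using that by (auto intro: power_mono)
  note * = stationary_integral_bounded[where f = "\<lambda>x. min x (real K) ^ p", OF _ bounds]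
  show "integrable N (\<lambda>a. min (W a) K ^ p)"
    and "AE a in N. integrable M (\<lambda>b. min (W a + X b) K ^ p)"
    and "integrable N (\<lambda>a. \<integral>b. min (W a + X b) K ^ p \<partial>M)"
    by (rule *; simp)+
  show "(\<integral>a. min (W a) K ^ p \<partial>N) = (1 - q) * (\<integral>a. \<integral>b. min (W a + X b) K ^ p \<partial>M \<partial>N)"
    \<comment> \<open>The reset term is \<open>q * min 0 K ^ p\<close>, which vanishes because
      \<open>p\<close> is positive.\<close>
    using *(4) assms by simp
qed

text \<open>For \<open>x \<ge> 0\<close>, \<open>min (w + x) K \<le> min w K + x\<close>.
  Integrating this in the stationarity equation bounds the truncated mean in terms of itself, and
  \<open>contraction_bound\<close> gives a bound free of \<open>K\<close>.\<close>

lemma truncated_mean_le: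
  assumes int: "integrable M X"
  shows "(\<integral>a. min (W a) (real K) \<partial>N) \<le> (1 - q) / q * (\<integral>b. X b \<partial>M)"
proof (rule contraction_bound)
  note trunc = truncated_power[of 1 K, simplified]
  have "AE a in N. (\<integral>b. min (W a + X b) K \<partial>M) \<le> min (W a) K + (\<integral>b. X b \<partial>M)"
    using trunc(2)
  proof eventually_elim
    case (elim a)
    have "(\<integral>b. min (W a + X b) K \<partial>M) \<le> (\<integral>b. min (W a) K + X b \<partial>M)"
    proof (rule integral_mono_AE)
      show "AE b in M. min (W a + X b) K \<le> min (W a) K + X b"
        using X_nonneg by eventually_elim auto
    qed (use elim int in auto)
    then show ?case using int by (simp add: M.prob_space)
  qed
  then have "(\<integral>a. \<integral>b. min (W a + X b) K \<partial>M \<partial>N) \<le> (\<integral>a. min (W a) K + (\<integral>b. X b \<partial>M) \<partial>N)"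
    using trunc by (intro integral_mono_AE) auto
  also have "\<dots> = (\<integral>a. min (W a) K \<partial>N) + (\<integral>b. X b \<partial>M)"
    using trunc by (simp add: N.prob_space)
  finally show "(\<integral>a. min (W a) K \<partial>N) \<le> (1 - q) * ((\<integral>a. min (W a) K \<partial>N) + (\<integral>b. X b \<partial>M))"
    using q by (subst trunc(4)) (rule mult_left_mono, auto)
qed

lemma mean_stationary:
  assumes int: "integrable M X"
  shows "integrable N W" and "(\<integral>a. W a \<partial>N) = (1 - q) / q * (\<integral>b. X b \<partial>M)"
proof -
  show W_int: "integrable N W"
  proof -
    have "integrable N (\<lambda>a. W a ^ 1)"
    proof (rule integrable_power_if_truncations_bounded[OF W W_nonneg])
      show "integrable N (\<lambda>a. min (W a) (real K) ^ 1)" for K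
        by (rule truncated_power) simp
      show "(\<integral>a. min (W a) (real K) ^ 1 \<partial>N) \<le> (1 - q) / q * (\<integral>b. X b \<partial>M)" for K
        using truncated_mean_le[OF int] by simp
    qed
    then show ?thesis by simp
  qed
  \<comment> \<open>Now that \<open>W\<close> is integrable, the equation applies to the identity
    function and is linear in the mean of \<open>W\<close>.\<close>
  have "(\<integral>a. W a \<partial>N) = q * 0 + (1 - q) * (\<integral>a. \<integral>b. W a + X b \<partial>M \<partial>N)"
    using int W_int by (intro stationary_integral(2)[where f = "\<lambda>x. x"]) (auto simp: M.prob_space)
  also have "(\<integral>a. \<integral>b. W a + X b \<partial>M \<partial>N) = (\<integral>a. W a \<partial>N) + (\<integral>b. X b \<partial>M)"
    using int W_int by (simp add: M.prob_space N.prob_space)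
  finally show "(\<integral>a. W a \<partial>N) = (1 - q) / q * (\<integral>b. X b \<partial>M)"
    using q by (simp add: field_simps)
qed

text \<open>For nonnegative \<open>w\<close> and \<open>x\<close>,
  \<open>(min (w + x) K)\<^sup>2\<close> is at most the expanded square of
  \<open>min w K + x\<close>. The cross term is controlled by the truncated mean, so the bound is
  again uniform in \<open>K\<close>.\<close>

lemma truncated_second_moment_le:
  assumes int2: "integrable M (\<lambda>b. (X b)\<^sup>2)"
  shows "(\<integral>a. (min (W a) (real K))\<^sup>2 \<partial>N) \<le> (1 - q) / q *
    (2 * ((1 - q) / q * (\<integral>b. X b \<partial>M)) * (\<integral>b. X b \<partial>M) + (\<integral>b. (X b)\<^sup>2 \<partial>M))"
proof (rule contraction_bound)
  have int: "integrable M X" by (rule M.square_integrable_imp_integrable[OF X int2])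
  note trunc1 = truncated_power(1)[of 1 K, simplified]
  note trunc = truncated_power[of 2 K, simplified]
  let ?m = "\<integral>b. X b \<partial>M" and ?s = "\<integral>b. (X b)\<^sup>2 \<partial>M"
  have m: "0 \<le> ?m" by (rule integral_nonneg_AE[OF X_nonneg])
  have "AE a in N. (\<integral>b. (min (W a + X b) K)\<^sup>2 \<partial>M) \<le> (min (W a) K)\<^sup>2 + 2 * min (W a) K * ?m + ?s"
    using trunc(2) W_nonneg
  proof eventually_elim
    case (elim a)
    have "(\<integral>b. (min (W a + X b) K)\<^sup>2 \<partial>M) \<le>
        (\<integral>b. (min (W a) K)\<^sup>2 + 2 * min (W a) K * X b + (X b)\<^sup>2 \<partial>M)"
    proof (rule integral_mono_AE)
      show "AE b in M. (min (W a + X b) K)\<^sup>2 \<le> (min (W a) K)\<^sup>2 + 2 * min (W a) K * X b + (X b)\<^sup>2"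
        using X_nonneg
      proof eventually_elim
        case (elim b)
        then have "(min (W a + X b) K)\<^sup>2 \<le> (min (W a) K + X b)\<^sup>2"
          using \<open>0 \<le> W a\<close> by (intro power_mono) auto
        then show ?case by (simp add: power2_sum algebra_simps)
      qed
    qed (use elim int int2 in auto)
    then show ?case using int int2 by (simp add: M.prob_space)
  qed
  then have "(\<integral>a. \<integral>b. (min (W a + X b) K)\<^sup>2 \<partial>M \<partial>N) \<le>
      (\<integral>a. (min (W a) K)\<^sup>2 + 2 * min (W a) K * ?m + ?s \<partial>N)"
    using trunc trunc1 by (intro integral_mono_AE) auto
  also have "\<dots> = (\<integral>a. (min (W a) K)\<^sup>2 \<partial>N) + (2 * (\<integral>a. min (W a) K \<partial>N) * ?m + ?s)"
    using trunc trunc1 by (simp add: N.prob_space)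
  \<comment> \<open>Replace the truncated mean by its bound; the sign of \<open>?m\<close> keeps the
    direction of the inequality.\<close>
  also have "\<dots> \<le> (\<integral>a. (min (W a) K)\<^sup>2 \<partial>N) + (2 * ((1 - q) / q * ?m) * ?m + ?s)"
    using truncated_mean_le[OF int, of K] m
    by (intro add_left_mono add_right_mono mult_right_mono mult_left_mono) auto
  finally show "(\<integral>a. (min (W a) K)\<^sup>2 \<partial>N) \<le>
      (1 - q) * ((\<integral>a. (min (W a) K)\<^sup>2 \<partial>N) + (2 * ((1 - q) / q * ?m) * ?m + ?s))"
    using q by (subst trunc(4)) (rule mult_left_mono, auto)
qed

text \<open>The uniform bound on truncated second moments makes the second moment finite; then the
  equation with \<open>f x = x\<^sup>2\<close> is solved for it, the cross term factoring into the
  two means.\<close>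

lemma second_moment_stationary:
  assumes int2: "integrable M (\<lambda>b. (X b)\<^sup>2)"
  shows "integrable N (\<lambda>a. (W a)\<^sup>2)"
    and "(\<integral>a. (W a)\<^sup>2 \<partial>N) =
      (1 - q) / q * (2 * (\<integral>a. W a \<partial>N) * (\<integral>b. X b \<partial>M) + (\<integral>b. (X b)\<^sup>2 \<partial>M))"
proof -
  have int: "integrable M X" by (rule M.square_integrable_imp_integrable[OF X int2])
  note W_int = mean_stationary(1)[OF int]
  show W_int2: "integrable N (\<lambda>a. (W a)\<^sup>2)"
    using truncated_power(1)[of 2] truncated_second_moment_le[OF int2]
    by (intro integrable_power_if_truncations_bounded[OF W W_nonneg]) auto
  let ?m = "\<integral>b. X b \<partial>M" and ?s = "\<integral>b. (X b)\<^sup>2 \<partial>M"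
  have inner_int: "integrable M (\<lambda>b. (W a + X b)\<^sup>2)"
    and inner: "(\<integral>b. (W a + X b)\<^sup>2 \<partial>M) = (W a)\<^sup>2 + 2 * W a * ?m + ?s" for a
    using int int2 by (simp_all add: power2_sum M.prob_space mult.assoc)
  have "(\<integral>a. (W a)\<^sup>2 \<partial>N) = q * 0\<^sup>2 + (1 - q) * (\<integral>a. \<integral>b. (W a + X b)\<^sup>2 \<partial>M \<partial>N)"
    using inner_int W_int W_int2
    by (intro stationary_integral(2)[where f = "\<lambda>x. x\<^sup>2"]) (auto simp: inner)
  also have "(\<integral>a. \<integral>b. (W a + X b)\<^sup>2 \<partial>M \<partial>N) = (\<integral>a. (W a)\<^sup>2 \<partial>N) + 2 * (\<integral>a. W a \<partial>N) * ?m + ?s"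
    using W_int W_int2 by (simp add: inner N.prob_space)
  finally show "(\<integral>a. (W a)\<^sup>2 \<partial>N) = (1 - q) / q * (2 * (\<integral>a. W a \<partial>N) * ?m + ?s)"
    using q by (simp add: field_simps)
qed

lemma variance_stationary:
  assumes int2: "integrable M (\<lambda>b. (X b)\<^sup>2)"
  shows "N.variance W =
    (1 - q) / q * (\<integral>b. (X b)\<^sup>2 \<partial>M) + (1 - q)\<^sup>2 / q\<^sup>2 * (\<integral>b. X b \<partial>M)\<^sup>2"
proof -
  have int: "integrable M X" by (rule M.square_integrable_imp_integrable[OF X int2])
  have "N.variance W = (\<integral>a. (W a)\<^sup>2 \<partial>N) - (\<integral>a. W a \<partial>N)\<^sup>2"
    using mean_stationary(1)[OF int] second_moment_stationary(1)[OF int2] by (rule N.variance_eq)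
  \<comment> \<open>With \<open>r = (1 - q) / q\<close> and \<open>m\<close>, \<open>s\<close> the
    first two moments of \<open>X\<close>, this reads \<open>r * (2 * r * m * m + s) - (r *
    m)\<^sup>2 = r * s + r\<^sup>2 * m\<^sup>2\<close>.\<close>
  also have "\<dots> = (1 - q) / q * (\<integral>b. (X b)\<^sup>2 \<partial>M) + (1 - q)\<^sup>2 / q\<^sup>2 * (\<integral>b. X b \<partial>M)\<^sup>2"
    unfolding second_moment_stationary(2)[OF int2] mean_stationary(2)[OF int]
    using q by (simp add: power2_eq_square field_simps)
  finally show ?thesis .
qed

end

theorem mainTheorem14:
  fixes q :: real
    and M :: "'a measure" and X :: "'a \<Rightarrow> real"
    and N :: "'b measure" and W :: "'b \<Rightarrow> real"
  assumes "0 < q" and "q < 1"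
    and "prob_space M" and "X \<in> borel_measurable M" and "AE \<omega> in M. 0 \<le> X \<omega>"
    and "prob_space N" and "W \<in> borel_measurable N"
    and "stationary_distribution q (distr M borel X) (distr N borel W)"
  shows "let F_X = cdf (distr M borel X); F_W = cdf (distr N borel W); P_delay = 1 - F_W 0 in
    (\<forall>t\<ge>0. prob_space.expectation N (\<lambda>\<omega>. exp (- t * W \<omega>)) =
       q / (1 - (1 - q) * prob_space.expectation M (\<lambda>\<omega>. exp (- t * X \<omega>)))) \<and>
    F_W 0 = q / (1 - (1 - q) * F_X 0) \<and>
    P_delay = (1 - q) * (1 - F_X 0) / (1 - (1 - q) * F_X 0) \<and>
    (integrable M X \<longrightarrow>
       integrable N W \<and>
       prob_space.expectation N W = (1 - q) / q * prob_space.expectation M X) \<and>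
    (integrable M (\<lambda>\<omega>. (X \<omega>)\<^sup>2) \<longrightarrow>
       integrable N (\<lambda>\<omega>. (W \<omega>)\<^sup>2) \<and>
       prob_space.variance N W =
         (1 - q) / q * prob_space.expectation M (\<lambda>\<omega>. (X \<omega>)\<^sup>2) +
         (1 - q)\<^sup>2 / q\<^sup>2 * (prob_space.expectation M X)\<^sup>2)"
proof -
  interpret stationary_pair M N q X W
    using assms by (intro stationary_pair.intro stationary_pair_axioms.intro)
  let ?F = "cdf (distr M borel X) 0"
  \<comment> \<open>Over the common positive denominator, the numerator is
    \<open>1 - (1 - q) * ?F - q = (1 - q) * (1 - ?F)\<close>.\<close>
  have "1 - cdf (distr N borel W) 0 = (1 - q) * (1 - ?F) / (1 - (1 - q) * ?F)"
    using cdf_0_stationary by (simp add: field_simps)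
  then show ?thesis
    unfolding Let_def
    using laplace_transform_stationary cdf_0_stationary(2) mean_stationary
      second_moment_stationary(1) variance_stationary
    by blast
qed

end
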